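(* Let $F:\mathsf{RBOLie}\to\mathsf{RBOLeibnizS}$ be the functor which sends a relative Rota-Baxter operator $T:V\to\mathfrak g$ on a Lie algebra $(\mathfrak g,[-,-]_{\mathfrak g})$ with respect to a representation $(V;\rho)$ to the same map $T:V\to\mathfrak g$, viewed as a relative Rota-Baxter operator on $(\mathfrak g,[-,-]_{\mathfrak g})$ regarded as a Leibniz algebra, with respect to the symmetric representation $(V;\rho,-\rho)$, and which sends a homomorphism $(\phi,\varphi)$ to $(\phi,\varphi)$. Then there is a functor $G$ from the category $\mathsf{RBOLeibnizS}$ of relative Rota-Baxter operators on Leibniz algebras with respect to symmetric representations to the category $\mathsf{RBOLie}$ of relative Rota-Baxter operators on Lie algebras, such that $G$ is a left adjoint for $F$.
   Context: All vector spaces are finite-dimensional over an algebraically closed field $\mathbb K$ of characteristic $0$. A (left) Leibniz algebra is a vector space $\mathfrak G$ with a bilinear operation $[-,-]_{\mathfrak G}$ such that $[x,[y,z]_{\mathfrak G}]_{\mathfrak G}=[[x,y]_{\mathfrak G},z]_{\mathfrak G}+[y,[x,z]_{\mathfrak G}]_{\mathfrak G}$ for all $x,y,z$. A representation of $\mathfrak G$ is a triple $(V;\rho^L,\rho^R)$ with $V$ a vector space and $\rho^L,\rho^R:\mathfrak G\to\mathfrak{gl}(V)$ linear such that for all $x,y\in\mathfrak G$: $\rho^L([x,y]_{\mathfrak G})=[\rho^L(x),\rho^L(y)]$, $\rho^R([x,y]_{\mathfrak G})=[\rho^L(x),\rho^R(y)]$, $\rho^R(y)\circ\rho^L(x)=-\rho^R(y)\circ\rho^R(x)$.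 It is symmetric if $\rho^R=-\rho^L$. Category $\mathsf{RBOLie}$: objects are relative Rota-Baxter operators on Lie algebras, i.e. linear maps $T:V\to\mathfrak g$, where $(V;\rho)$ is a representation of a Lie algebra $\mathfrak g$, with $[Tu,Tv]_{\mathfrak g}=T(\rho(Tu)v-\rho(Tv)u)$ for all $u,v\in V$. A morphism from $T:V\to\mathfrak g$ to $T':V'\to\mathfrak g'$ is a pair $(\phi,\varphi)$ with $\phi:\mathfrak g\to\mathfrak g'$ a Lie algebra homomorphism and $\varphi:V\to V'$ linear such that $T'\circ\varphi=\phi\circ T$ and $\varphi(\rho(x)u)=\rho'(\phi(x))\varphi(u)$ for all $x\in\mathfrak g$, $u\in V$. Category $\mathsf{RBOLeibnizS}$: objects are linear maps $T:V\to\mathfrak G$, where $(V;\rho^L,\rho^R)$ is a symmetric representation of a Leibniz algebra $\mathfrak G$, with $[Tu,Tv]_{\mathfrak G}=T(\rho^L(Tu)v+\rho^R(Tv)u)$ for all $u,v\in V$. A morphism from $T:V\to\mathfrak G$ to $T':V'\to\mathfrak G'$ is a pair $(\phi,\varphi)$ with $\phi:\mathfrak G\to\mathfrak G'$ a Leibniz algebra homomorphism and $\varphi:V\to V'$ linear such that $T'\circ\varphi=\phi\circ T$, $\varphi(\rho^L(x)u)={\rho^L}'(\phi(x))\varphi(u)$ and $\varphi(\rho^R(x)u)={\rho^R}'(\phi(x))\varphi(u)$ for all $x\in\mathfrak G$, $u\in V$. *)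

theory Defs
  imports
    "HOL-Algebra.Algebraic_Closure"
    "Jordan_Normal_Form.Missing_VectorSpace"
begin

section \<open>Categories, functors and adjunctions\<close>

text \<open>
  Hom-sets are indexed by their source and target, and need not be disjoint. Accordingly
  composition and the arrow map of a functor take the objects involved as arguments:
  \<open>Comp C A B E g f\<close> is the composite of \<open>f : A \<rightarrow> B\<close> and \<open>g : B \<rightarrow> E\<close>.
\<close>

record ('o, 'm) category =
  Obj :: "'o set"
  Hom :: "'o \<Rightarrow> 'o \<Rightarrow> 'm set"
  Ident :: "'o \<Rightarrow> 'm"
  Comp :: "'o \<Rightarrow> 'o \<Rightarrow> 'o \<Rightarrow> 'm \<Rightarrow> 'm \<Rightarrow> 'm"

locale category =
  fixes C :: "('o, 'm) category"
  assumes ident_in_hom: "A \<in> Obj C \<Longrightarrow> Ident C A \<in> Hom C A A"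
    and comp_in_hom:
      "\<lbrakk>A \<in> Obj C; B \<in> Obj C; E \<in> Obj C; f \<in> Hom C A B; g \<in> Hom C B E\<rbrakk>
        \<Longrightarrow> Comp C A B E g f \<in> Hom C A E"
    and comp_ident_left:
      "\<lbrakk>A \<in> Obj C; B \<in> Obj C; f \<in> Hom C A B\<rbrakk> \<Longrightarrow> Comp C A B B (Ident C B) f = f"
    and comp_ident_right:
      "\<lbrakk>A \<in> Obj C; B \<in> Obj C; f \<in> Hom C A B\<rbrakk> \<Longrightarrow> Comp C A A B f (Ident C A) = f"
    and comp_assoc:
      "\<lbrakk>P \<in> Obj C; Q \<in> Obj C; R \<in> Obj C; S \<in> Obj C;
        f \<in> Hom C P Q; g \<in> Hom C Q R; h \<in> Hom C R S\<rbrakk>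
        \<Longrightarrow> Comp C P R S h (Comp C P Q R g f) = Comp C P Q S (Comp C Q R S h g) f"

record ('o1, 'm1, 'o2, 'm2) functor_data =
  omap :: "'o1 \<Rightarrow> 'o2"
  amap :: "'o1 \<Rightarrow> 'o1 \<Rightarrow> 'm1 \<Rightarrow> 'm2"

locale is_functor = C: category C + D: category D
  for C :: "('o1, 'm1) category" and D :: "('o2, 'm2) category" +
  fixes F :: "('o1, 'm1, 'o2, 'm2) functor_data"
  assumes omap_in_obj: "A \<in> Obj C \<Longrightarrow> omap F A \<in> Obj D"
    and amap_in_hom:
      "\<lbrakk>A \<in> Obj C; B \<in> Obj C; f \<in> Hom C A B\<rbrakk>
        \<Longrightarrow> amap F A B f \<in> Hom D (omap F A) (omap F B)"
    and amap_ident: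
      "A \<in> Obj C \<Longrightarrow> amap F A A (Ident C A) = Ident D (omap F A)"
    and amap_comp:
      "\<lbrakk>A \<in> Obj C; B \<in> Obj C; E \<in> Obj C; f \<in> Hom C A B; g \<in> Hom C B E\<rbrakk>
        \<Longrightarrow> amap F A E (Comp C A B E g f) =
            Comp D (omap F A) (omap F B) (omap F E) (amap F B E g) (amap F A B f)"

text \<open>
  \<open>G : D \<rightarrow> C\<close> is left adjoint to \<open>F : C \<rightarrow> D\<close>: there are bijections
  \<open>\<Phi> A B : Hom C (G A) B \<rightarrow> Hom D A (F B)\<close> with
  \<open>\<Phi> A' B' (k \<circ> f \<circ> G h) = F k \<circ> \<Phi> A B f \<circ> h\<close> for all \<open>h : A' \<rightarrow> A\<close> in \<open>D\<close> and
  \<open>k : B \<rightarrow> B'\<close> in \<open>C\<close>.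
\<close>

definition left_adjoint ::
  "('o2, 'm2) category \<Rightarrow> ('o1, 'm1) category \<Rightarrow>
   ('o2, 'm2, 'o1, 'm1) functor_data \<Rightarrow> ('o1, 'm1, 'o2, 'm2) functor_data \<Rightarrow> bool"
where
  "left_adjoint D C G F \<longleftrightarrow>
     is_functor D C G \<and> is_functor C D F \<and>
     (\<exists>\<Phi> :: 'o2 \<Rightarrow> 'o1 \<Rightarrow> 'm1 \<Rightarrow> 'm2.
        (\<forall>A \<in> Obj D. \<forall>B \<in> Obj C.
           bij_betw (\<Phi> A B) (Hom C (omap G A) B) (Hom D A (omap F B))) \<and>
        (\<forall>A \<in> Obj D. \<forall>A' \<in> Obj D. \<forall>B \<in> Obj C. \<forall>B' \<in> Obj C.
         \<forall>h \<in> Hom D A' A. \<forall>k \<in> Hom C B B'. \<forall>f \<in> Hom C (omap G A) B.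
           \<Phi> A' B' (Comp C (omap G A') (omap G A) B'
                      (Comp C (omap G A) B B' k f) (amap G A' A h)) =
           Comp D A' A (omap F B')
             (Comp D A (omap F B) (omap F B') (amap F B B' k) (\<Phi> A B f)) h))"

section \<open>Lie and Leibniz algebras and their representations\<close>

locale alg_closed_field_char_0 = algebraically_closed K for K (structure) +
  assumes char_0: "0 < (n :: nat) \<Longrightarrow> [n] \<cdot> \<one> \<noteq> \<zero>"

locale fin_dim_vectorspace = vectorspace K V for K and V +
  assumes finite_dimensional: fin_dim

text \<open>The \<open>mult\<close> and \<open>one\<close> slots inherited from \<^typ>\<open>('k, 'a) module\<close> are not used.\<close>

record ('k, 'a) bracket_space = "('k, 'a) module" +
  bracket :: "'a \<Rightarrow> 'a \<Rightarrow> 'a"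

text \<open>
  A linear map \<open>\<rho>\<close> from \<open>U\<close> to the linear maps \<open>V \<rightarrow> W\<close>, written as a curried bilinear map.
\<close>

definition bilinear_map where
  "bilinear_map K U V W \<rho> \<longleftrightarrow>
     (\<forall>x \<in> carrier U. \<rho> x \<in> module_hom K V W) \<and>
     (\<forall>v \<in> carrier V. (\<lambda>x. \<rho> x v) \<in> module_hom K U W)"

locale leibniz_algebra = fin_dim_vectorspace K \<GG>
  for K :: "('k, 'r) ring_scheme" and \<GG> :: "('k, 'a) bracket_space" (structure) +
  assumes bracket_bilinear: "bilinear_map K \<GG> \<GG> \<GG> (bracket \<GG>)"
    and left_leibniz:
      "\<lbrakk>x \<in> carrier \<GG>; y \<in> carrier \<GG>; z \<in> carrier \<GG>\<rbrakk> \<Longrightarrow>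
        bracket \<GG> x (bracket \<GG> y z) =
        bracket \<GG> (bracket \<GG> x y) z \<oplus> bracket \<GG> y (bracket \<GG> x z)"

locale lie_algebra = fin_dim_vectorspace K \<gg>
  for K :: "('k, 'r) ring_scheme" and \<gg> :: "('k, 'a) bracket_space" (structure) +
  assumes bracket_bilinear: "bilinear_map K \<gg> \<gg> \<gg> (bracket \<gg>)"
    and alternating: "x \<in> carrier \<gg> \<Longrightarrow> bracket \<gg> x x = \<zero>"
    and jacobi:
      "\<lbrakk>x \<in> carrier \<gg>; y \<in> carrier \<gg>; z \<in> carrier \<gg>\<rbrakk> \<Longrightarrow>
        bracket \<gg> x (bracket \<gg> y z) \<oplus> bracket \<gg> y (bracket \<gg> z x)
          \<oplus> bracket \<gg> z (bracket \<gg> x y) = \<zero>"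

definition bracket_hom ::
  "('k, 'r) ring_scheme \<Rightarrow> ('k, 'a) bracket_space \<Rightarrow> ('k, 'b) bracket_space \<Rightarrow> ('a \<Rightarrow> 'b) set"
where
  "bracket_hom K \<gg> \<hh> =
     {\<phi> \<in> module_hom K \<gg> \<hh>.
        \<forall>x \<in> carrier \<gg>. \<forall>y \<in> carrier \<gg>. \<phi> (bracket \<gg> x y) = bracket \<hh> (\<phi> x) (\<phi> y)}"

locale lie_representation = \<gg>: lie_algebra K \<gg> + fin_dim_vectorspace K V
  for K :: "('k, 'r) ring_scheme" and \<gg> :: "('k, 'a) bracket_space"
    and V :: "('k, 'b) module" (structure) +
  fixes \<rho> :: "'a \<Rightarrow> 'b \<Rightarrow> 'b"
  assumes \<rho>_linear: "bilinear_map K \<gg> V V \<rho>"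
    and \<rho>_bracket:
      "\<lbrakk>x \<in> carrier \<gg>; y \<in> carrier \<gg>; u \<in> carrier V\<rbrakk> \<Longrightarrow>
        \<rho> (bracket \<gg> x y) u = \<rho> x (\<rho> y u) \<ominus> \<rho> y (\<rho> x u)"

locale leibniz_representation = \<GG>: leibniz_algebra K \<GG> + fin_dim_vectorspace K V
  for K :: "('k, 'r) ring_scheme" and \<GG> :: "('k, 'a) bracket_space"
    and V :: "('k, 'b) module" (structure) +
  fixes \<rho>L \<rho>R :: "'a \<Rightarrow> 'b \<Rightarrow> 'b"
  assumes \<rho>L_linear: "bilinear_map K \<GG> V V \<rho>L"
    and \<rho>R_linear: "bilinear_map K \<GG> V V \<rho>R"
    and \<rho>L_bracket:
      "\<lbrakk>x \<in> carrier \<GG>; y \<in> carrier \<GG>; u \<in> carrier V\<rbrakk> \<Longrightarrow>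
        \<rho>L (bracket \<GG> x y) u = \<rho>L x (\<rho>L y u) \<ominus> \<rho>L y (\<rho>L x u)"
    and \<rho>R_bracket:
      "\<lbrakk>x \<in> carrier \<GG>; y \<in> carrier \<GG>; u \<in> carrier V\<rbrakk> \<Longrightarrow>
        \<rho>R (bracket \<GG> x y) u = \<rho>L x (\<rho>R y u) \<ominus> \<rho>R y (\<rho>L x u)"
    and \<rho>R_\<rho>L:
      "\<lbrakk>x \<in> carrier \<GG>; y \<in> carrier \<GG>; u \<in> carrier V\<rbrakk> \<Longrightarrow>
        \<rho>R y (\<rho>L x u) = \<ominus> \<rho>R y (\<rho>R x u)"

locale symmetric_leibniz_representation = leibniz_representation K \<GG> V \<rho>L \<rho>R
  for K :: "('k, 'r) ring_scheme" and \<GG> :: "('k, 'a) bracket_space"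
    and V :: "('k, 'b) module" (structure) and \<rho>L \<rho>R +
  assumes symmetric:
    "\<lbrakk>x \<in> carrier \<GG>; u \<in> carrier V\<rbrakk> \<Longrightarrow> \<rho>R x u = \<ominus> \<rho>L x u"

section \<open>The two categories of relative Rota-Baxter operators\<close>

record ('k, 'a, 'b) rbo_lie =
  lie_alg :: "('k, 'a) bracket_space"
  lie_mod :: "('k, 'b) module"
  lie_act :: "'a \<Rightarrow> 'b \<Rightarrow> 'b"
  lie_op :: "'b \<Rightarrow> 'a"

record ('k, 'a, 'b) rbo_leibniz =
  leib_alg :: "('k, 'a) bracket_space"
  leib_mod :: "('k, 'b) module"
  leib_actL :: "'a \<Rightarrow> 'b \<Rightarrow> 'b"
  leib_actR :: "'a \<Rightarrow> 'b \<Rightarrow> 'b"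
  leib_op :: "'b \<Rightarrow> 'a"

locale relative_rota_baxter_lie =
  lie_representation K "lie_alg A" "lie_mod A" "lie_act A"
  for K :: "('k, 'r) ring_scheme" and A :: "('k, 'a, 'b) rbo_lie" +
  assumes op_linear: "lie_op A \<in> module_hom K (lie_mod A) (lie_alg A)"
    and rota_baxter:
      "\<lbrakk>u \<in> carrier (lie_mod A); v \<in> carrier (lie_mod A)\<rbrakk> \<Longrightarrow>
        bracket (lie_alg A) (lie_op A u) (lie_op A v) =
        lie_op A (lie_act A (lie_op A u) v \<ominus>\<^bsub>lie_mod A\<^esub> lie_act A (lie_op A v) u)"

locale relative_rota_baxter_leibniz_sym =
  symmetric_leibniz_representation K "leib_alg A" "leib_mod A" "leib_actL A" "leib_actR A"
  for K :: "('k, 'r) ring_scheme" and A :: "('k, 'a, 'b) rbo_leibniz" +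
  assumes op_linear: "leib_op A \<in> module_hom K (leib_mod A) (leib_alg A)"
    and rota_baxter:
      "\<lbrakk>u \<in> carrier (leib_mod A); v \<in> carrier (leib_mod A)\<rbrakk> \<Longrightarrow>
        bracket (leib_alg A) (leib_op A u) (leib_op A v) =
        leib_op A (leib_actL A (leib_op A u) v \<oplus>\<^bsub>leib_mod A\<^esub> leib_actR A (leib_op A v) u)"

text \<open>
  Morphisms are pairs of maps that are \<^const>\<open>undefined\<close> outside the respective carriers, so that
  two morphisms are equal precisely when they agree on the carriers.
\<close>

type_synonym ('a, 'b) rbo_arrow = "('a \<Rightarrow> 'a) \<times> ('b \<Rightarrow> 'b)"

definition rbo_lie_hom ::
  "('k, 'r) ring_scheme \<Rightarrow> ('k, 'a, 'b) rbo_lie \<Rightarrow> ('k, 'a, 'b) rbo_lie \<Rightarrow> ('a, 'b) rbo_arrow set"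
where
  "rbo_lie_hom K A B =
     {(\<phi>, \<psi>).
        \<phi> \<in> bracket_hom K (lie_alg A) (lie_alg B) \<and> \<phi> \<in> extensional (carrier (lie_alg A)) \<and>
        \<psi> \<in> module_hom K (lie_mod A) (lie_mod B) \<and> \<psi> \<in> extensional (carrier (lie_mod A)) \<and>
        (\<forall>u \<in> carrier (lie_mod A). lie_op B (\<psi> u) = \<phi> (lie_op A u)) \<and>
        (\<forall>x \<in> carrier (lie_alg A). \<forall>u \<in> carrier (lie_mod A).
           \<psi> (lie_act A x u) = lie_act B (\<phi> x) (\<psi> u))}"

definition rbo_leibniz_hom ::
  "('k, 'r) ring_scheme \<Rightarrow> ('k, 'a, 'b) rbo_leibniz \<Rightarrow> ('k, 'a, 'b) rbo_leibniz \<Rightarrow>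
   ('a, 'b) rbo_arrow set"
where
  "rbo_leibniz_hom K A B =
     {(\<phi>, \<psi>).
        \<phi> \<in> bracket_hom K (leib_alg A) (leib_alg B) \<and> \<phi> \<in> extensional (carrier (leib_alg A)) \<and>
        \<psi> \<in> module_hom K (leib_mod A) (leib_mod B) \<and> \<psi> \<in> extensional (carrier (leib_mod A)) \<and>
        (\<forall>u \<in> carrier (leib_mod A). leib_op B (\<psi> u) = \<phi> (leib_op A u)) \<and>
        (\<forall>x \<in> carrier (leib_alg A). \<forall>u \<in> carrier (leib_mod A).
           \<psi> (leib_actL A x u) = leib_actL B (\<phi> x) (\<psi> u)) \<and>
        (\<forall>x \<in> carrier (leib_alg A). \<forall>u \<in> carrier (leib_mod A).
           \<psi> (leib_actR A x u) = leib_actR B (\<phi> x) (\<psi> u))}"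

text \<open>
  The type variables \<open>'a\<close> and \<open>'b\<close> play the role of universes: the carriers of the algebras
  range over subsets of \<open>'a\<close>, those of the representation spaces over subsets of \<open>'b\<close>, each with
  arbitrary operations. If these types have at least the cardinality of an infinite \<open>K\<close>, every
  finite-dimensional vector space is isomorphic to one with carrier in them.
\<close>

definition RBOLie ::
  "('k, 'r) ring_scheme \<Rightarrow> (('k, 'a, 'b) rbo_lie, ('a, 'b) rbo_arrow) category"
where
  "RBOLie K =
     \<lparr>Obj = {A. relative_rota_baxter_lie K A},
      Hom = rbo_lie_hom K,
      Ident = (\<lambda>A. (\<lambda>x \<in> carrier (lie_alg A). x, \<lambda>u \<in> carrier (lie_mod A). u)),
      Comp = (\<lambda>A B E g f.
        (compose (carrier (lie_alg A)) (fst g) (fst f),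
         compose (carrier (lie_mod A)) (snd g) (snd f)))\<rparr>"

definition RBOLeibnizS ::
  "('k, 'r) ring_scheme \<Rightarrow> (('k, 'a, 'b) rbo_leibniz, ('a, 'b) rbo_arrow) category"
where
  "RBOLeibnizS K =
     \<lparr>Obj = {A. relative_rota_baxter_leibniz_sym K A},
      Hom = rbo_leibniz_hom K,
      Ident = (\<lambda>A. (\<lambda>x \<in> carrier (leib_alg A). x, \<lambda>u \<in> carrier (leib_mod A). u)),
      Comp = (\<lambda>A B E g f.
        (compose (carrier (leib_alg A)) (fst g) (fst f),
         compose (carrier (leib_mod A)) (snd g) (snd f)))\<rparr>"

definition lie_to_leibniz ::
  "(('k, 'a, 'b) rbo_lie, ('a, 'b) rbo_arrow, ('k, 'a, 'b) rbo_leibniz, ('a, 'b) rbo_arrow)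
     functor_data"
where
  "lie_to_leibniz =
     \<lparr>omap = (\<lambda>A. \<lparr>leib_alg = lie_alg A,
                    leib_mod = lie_mod A,
                    leib_actL = lie_act A,
                    leib_actR = (\<lambda>x u. \<ominus>\<^bsub>lie_mod A\<^esub> lie_act A x u),
                    leib_op = lie_op A\<rparr>),
      amap = (\<lambda>A B f. f)\<rparr>"

end

theory Submission
  imports Defs
begin

text \<open>
  In a Leibniz algebra the span of the squares \<open>[x, x]\<close> is an ideal, and the quotient by it is the
  largest Lie quotient. The identity \<open>\<rho>L [x, x] = [\<rho>L x, \<rho>L x] = 0\<close> shows that the left action factors
  through this quotient, and because \<open>\<rho>R = - \<rho>L\<close> the Rota-Baxter identity survives composing \<open>T\<close> with
  the projection. So the left adjoint keeps the representation space and only replaces the algebra;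
  the projection together with the identity of the space is the universal arrow.
\<close>

text \<open>Two observations keep the checking small. A linear map that intertwines \<rho> also
  intertwines -\<rho>, so source and target of \<open>lie_to_leibniz\<close> have literally equal
  hom-sets, and the category laws of \<open>RBOLie\<close> are inherited from those of
  \<open>RBOLeibnizS\<close>. And the vector space and Leibniz axioms of the quotient are not
  verified by hand: they are transported along the surjection \<open>lie_repr\<close>, which
  preserves all operations. Squares are the right elements to divide by because every homomorphism
  into a Lie algebra kills them. Such a homomorphism is therefore unchanged by precomposition with
  \<open>lie_repr\<close>, and its factorisation through the quotient is just its restriction to the
  representatives. For the same reason \<open>\<rho>L\<close> acts on the quotient without being
  redefined.\<close>

section \<open>Left adjoints from universal arrows\<close>

text \<open>Arrows, identities and composites of \<open>C\<close> are those of \<open>D\<close>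
  between the images, so the laws of \<open>D\<close> restrict to \<open>C\<close>. Thus
  \<open>C\<close> is obtained as a category along with the functor.\<close>

lemma is_functor_full_inclusion:
  fixes C :: "('o1, 'm) category" and D :: "('o2, 'm) category"
  assumes "category D"
    and obj: "\<And>A. A \<in> Obj C \<Longrightarrow> \<iota> A \<in> Obj D"
    and hom: "\<And>A B. \<lbrakk>A \<in> Obj C; B \<in> Obj C\<rbrakk> \<Longrightarrow> Hom C A B = Hom D (\<iota> A) (\<iota> B)"
    and ident: "\<And>A. A \<in> Obj C \<Longrightarrow> Ident C A = Ident D (\<iota> A)"
    and comp: "\<And>A B E. \<lbrakk>A \<in> Obj C; B \<in> Obj C; E \<in> Obj C\<rbrakk> \<Longrightarrow>
      Comp C A B E = Comp D (\<iota> A) (\<iota> B) (\<iota> E)"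
  shows "is_functor C D \<lparr>omap = \<iota>, amap = \<lambda>A B f. f\<rparr>"
proof -
  interpret D: category D by fact
  show ?thesis
    by unfold_locales
      (simp_all add: obj hom ident comp D.ident_in_hom D.comp_in_hom D.comp_ident_left
        D.comp_ident_right D.comp_assoc)
qed

text \<open>The universal arrows \<open>\<eta>\<close> play the unit of the adjunction.
  Transposition \<open>\<Phi>\<close> sends \<open>f\<close> to \<open>F f\<close> after
  \<open>\<eta>\<close>; unique factorisation makes it bijective, and equations between arrows out
  of \<open>G0 A\<close> can be checked on transposes.\<close>

lemma left_adjoint_of_universal_arrows:
  fixes C :: "('o1, 'm1) category" and D :: "('o2, 'm2) category"
  assumes F: "is_functor C D F"
    and univ: "\<And>A. A \<in> Obj D \<Longrightarrow>
      \<exists>B \<in> Obj C. \<exists>\<eta> \<in> Hom D A (omap F B). \<forall>B' \<in> Obj C. \<forall>g \<in> Hom D A (omap F B').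
        \<exists>!f. f \<in> Hom C B B' \<and> Comp D A (omap F B) (omap F B') (amap F B B' f) \<eta> = g"
  shows "\<exists>G. left_adjoint D C G F"
proof -
  interpret is_functor C D F by (rule F)
  obtain G0 \<eta> where G0: "\<And>A. A \<in> Obj D \<Longrightarrow> G0 A \<in> Obj C"
    and \<eta>: "\<And>A. A \<in> Obj D \<Longrightarrow> \<eta> A \<in> Hom D A (omap F (G0 A))"
    and ex1: "\<And>A B g. \<lbrakk>A \<in> Obj D; B \<in> Obj C; g \<in> Hom D A (omap F B)\<rbrakk> \<Longrightarrow>
      \<exists>!f. f \<in> Hom C (G0 A) B \<and>
        Comp D A (omap F (G0 A)) (omap F B) (amap F (G0 A) B f) (\<eta> A) = g"
    using univ by metis
  define \<Phi> where
    "\<Phi> A B f = Comp D A (omap F (G0 A)) (omap F B) (amap F (G0 A) B f) (\<eta> A)" for A B f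
  define \<Psi> where "\<Psi> A B g = (THE f. f \<in> Hom C (G0 A) B \<and> \<Phi> A B f = g)" for A B g
  \<comment> \<open>The arrow map is forced: \<open>G1 A A' h\<close> is the arrow whose transpose
    is \<open>\<eta> A'\<close> after \<open>h\<close>, which is exactly naturality of
    \<open>\<eta>\<close>.\<close>
  define G1 where
    "G1 A A' h = \<Psi> A (G0 A') (Comp D A A' (omap F (G0 A')) (\<eta> A') h)" for A A' h
  define G where "G = \<lparr>omap = G0, amap = G1\<rparr>"
  note obj = G0 omap_in_obj
  have \<Psi>: "\<Psi> A B g \<in> Hom C (G0 A) B" "\<Phi> A B (\<Psi> A B g) = g"
    if "A \<in> Obj D" "B \<in> Obj C" "g \<in> Hom D A (omap F B)" for A B g
    using theI'[OF ex1[OF that]] unfolding \<Psi>_def \<Phi>_def by auto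
  have \<Phi>_hom: "\<Phi> A B f \<in> Hom D A (omap F B)"
    if "A \<in> Obj D" "B \<in> Obj C" "f \<in> Hom C (G0 A) B" for A B f
    using that unfolding \<Phi>_def by (intro D.comp_in_hom[OF _ _ _ \<eta> amap_in_hom] obj)
  have \<Phi>_inj: "f = f'"
    if "A \<in> Obj D" "B \<in> Obj C" "f \<in> Hom C (G0 A) B" "f' \<in> Hom C (G0 A) B"
      "\<Phi> A B f = \<Phi> A B f'" for A B f f'
    using ex1[OF that(1,2) \<Phi>_hom[OF that(1-3)]] that(3-5) unfolding \<Phi>_def by metis
  have \<eta>_comp: "Comp D A A' (omap F (G0 A')) (\<eta> A') h \<in> Hom D A (omap F (G0 A'))"
    if "A \<in> Obj D" "A' \<in> Obj D" "h \<in> Hom D A A'" for A A' h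
    by (intro D.comp_in_hom[OF _ _ _ _ \<eta>] obj that)
  have G1: "G1 A A' h \<in> Hom C (G0 A) (G0 A')"
    "\<Phi> A (G0 A') (G1 A A' h) = Comp D A A' (omap F (G0 A')) (\<eta> A') h"
    if "A \<in> Obj D" "A' \<in> Obj D" "h \<in> Hom D A A'" for A A' h
    unfolding G1_def by (rule \<Psi>[OF that(1) G0[OF that(2)] \<eta>_comp[OF that]])+
  have \<Phi>_post: "\<Phi> A B' (Comp C (G0 A) B B' k f) =
      Comp D A (omap F B) (omap F B') (amap F B B' k) (\<Phi> A B f)"
    if "A \<in> Obj D" "B \<in> Obj C" "B' \<in> Obj C" "k \<in> Hom C B B'" "f \<in> Hom C (G0 A) B" for A B B' k f
    unfolding \<Phi>_def using that
    by (subst amap_comp) (simp_all add: obj \<eta> amap_in_hom D.comp_assoc)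
  have \<Phi>_pre: "\<Phi> A' B (Comp C (G0 A') (G0 A) B f (G1 A' A h)) = Comp D A' A (omap F B) (\<Phi> A B f) h"
    if "A \<in> Obj D" "A' \<in> Obj D" "B \<in> Obj C" "h \<in> Hom D A' A" "f \<in> Hom C (G0 A) B" for A A' B h f
    unfolding \<Phi>_post[OF that(2) G0[OF that(1)] that(3) that(5) G1(1)[OF that(2,1,4)]]
      G1(2)[OF that(2,1,4)] unfolding \<Phi>_def
    by (rule D.comp_assoc) (use that in \<open>auto intro: obj \<eta> amap_in_hom\<close>)
  have functor_G: "is_functor D C G"
  proof
    fix A assume A: "A \<in> Obj D"
    show "omap G A \<in> Obj C" using G0[OF A] by (simp add: G_def)
    show "amap G A A (Ident D A) = Ident C (omap G A)"
      unfolding G_def functor_data.simps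
    proof (rule \<Phi>_inj[OF A G0[OF A] G1(1)[OF A A] C.ident_in_hom])
      \<comment> \<open>Both transposes reduce to \<open>\<eta> A\<close>.\<close>
      show "\<Phi> A (G0 A) (G1 A A (Ident D A)) = \<Phi> A (G0 A) (Ident C (G0 A))"
        unfolding G1(2)[OF A A D.ident_in_hom[OF A]] unfolding \<Phi>_def
        using A by (simp add: amap_ident obj \<eta> D.comp_ident_left D.comp_ident_right)
    qed (use A in \<open>auto intro: D.ident_in_hom G0\<close>)
  next
    fix A B f assume "A \<in> Obj D" "B \<in> Obj D" "f \<in> Hom D A B"
    then show "amap G A B f \<in> Hom C (omap G A) (omap G B)" by (simp add: G_def G1)
  next
    fix A B E f g
    assume *: "A \<in> Obj D" "B \<in> Obj D" "E \<in> Obj D" "f \<in> Hom D A B" "g \<in> Hom D B E"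
    have gf: "Comp D A B E g f \<in> Hom D A E" using * by (intro D.comp_in_hom)
    \<comment> \<open>Both transposes are \<open>\<eta> E\<close> after \<open>g\<close> after
      \<open>f\<close>.\<close>
    have "\<Phi> A (G0 E) (G1 A E (Comp D A B E g f)) =
      \<Phi> A (G0 E) (Comp C (G0 A) (G0 B) (G0 E) (G1 B E g) (G1 A B f))"
      using * by (simp add: G1 gf \<Phi>_pre obj \<eta> D.comp_assoc)
    then have "G1 A E (Comp D A B E g f) = Comp C (G0 A) (G0 B) (G0 E) (G1 B E g) (G1 A B f)"
      by (rule \<Phi>_inj[rotated -1]) (use * gf in \<open>auto intro!: G1 G0 C.comp_in_hom\<close>)
    then show "amap G A E (Comp D A B E g f) =
        Comp C (omap G A) (omap G B) (omap G E) (amap G B E g) (amap G A B f)"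
      by (simp add: G_def)
  qed
  have "bij_betw (\<Phi> A B) (Hom C (omap G A) B) (Hom D A (omap F B))"
    if A: "A \<in> Obj D" and B: "B \<in> Obj C" for A B
    unfolding G_def functor_data.simps
    by (rule bij_betw_byWitness[where f' = "\<Psi> A B"])
      (use \<Psi>[OF A B] \<Phi>_hom[OF A B] \<Phi>_inj[OF A B] in auto)
  moreover have "\<Phi> A' B' (Comp C (omap G A') (omap G A) B'
        (Comp C (omap G A) B B' k f) (amap G A' A h)) =
      Comp D A' A (omap F B') (Comp D A (omap F B) (omap F B') (amap F B B' k) (\<Phi> A B f)) h"
    if "A \<in> Obj D" "A' \<in> Obj D" "B \<in> Obj C" "B' \<in> Obj C" "h \<in> Hom D A' A" "k \<in> Hom C B B'"
      "f \<in> Hom C (omap G A) B" for A A' B B' h k f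
    using that by (simp add: G_def \<Phi>_pre \<Phi>_post G0 C.comp_in_hom)
  ultimately show ?thesis
    unfolding left_adjoint_def using functor_G F by blast
qed

section \<open>Linear and bracket-preserving maps\<close>

lemma module_hom_compose:
  assumes "f \<in> module_hom K U V" and "g \<in> module_hom K V W"
  shows "(\<lambda>x. g (f x)) \<in> module_hom K U W"
  using assms by (auto simp: module_hom_def Pi_iff)

lemma bracket_hom_compose:
  assumes "\<phi> \<in> bracket_hom K \<gg> \<hh>" and "\<chi> \<in> bracket_hom K \<hh> \<kk>"
  shows "(\<lambda>x. \<chi> (\<phi> x)) \<in> bracket_hom K \<gg> \<kk>"
  using assms by (auto simp: bracket_hom_def module_hom_def Pi_iff)

lemma module_hom_restrict:
  assumes "module K M" and "f \<in> module_hom K M N"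
  shows "restrict f (carrier M) \<in> module_hom K M N"
proof -
  interpret module K M by fact
  show ?thesis using assms(2) by (auto simp: module_hom_def)
qed

text \<open>Nothing is known about \<open>W\<close> beforehand. Each axiom is a statement about all
  elements of \<open>W\<close>; by surjectivity these are images \<open>f v\<close>, and pulling the
  operations inside \<open>f\<close> leaves the axiom for \<open>V\<close>. The condition on zero
  ties the zero field of \<open>W\<close>, which linearity does not mention, to the other
  operations.\<close>

lemma vectorspace_surj_image:
  assumes "vectorspace K V" and f: "f \<in> module_hom K V W"
    and surj: "f ` carrier V = carrier W" and zero: "f \<zero>\<^bsub>V\<^esub> = \<zero>\<^bsub>W\<^esub>"
  shows "vectorspace K W"
proof -
  interpret V: vectorspace K V by fact
  note hom = module_hom_add[OF f, symmetric] module_hom_smult[OF f, symmetric] zero[symmetric]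
  have ball: "(\<forall>w \<in> carrier W. P w) \<longleftrightarrow> (\<forall>v \<in> carrier V. P (f v))" for P
    by (simp flip: surj)
  have mem: "f v \<in> carrier W" if "v \<in> carrier V" for v
    using surj that by blast
  have "\<forall>w \<in> carrier W. \<exists>w' \<in> carrier W. w \<oplus>\<^bsub>W\<^esub> w' = \<zero>\<^bsub>W\<^esub>"
    unfolding ball
  proof
    fix v assume v: "v \<in> carrier V"
    then have "f v \<oplus>\<^bsub>W\<^esub> f (\<ominus>\<^bsub>V\<^esub> v) = \<zero>\<^bsub>W\<^esub>"
      by (simp add: hom V.r_neg)
    with v show "\<exists>w' \<in> carrier W. f v \<oplus>\<^bsub>W\<^esub> w' = \<zero>\<^bsub>W\<^esub>"
      by (metis mem V.a_inv_closed)
  qed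
  moreover have "\<forall>v \<in> carrier W. \<forall>w \<in> carrier W. v \<oplus>\<^bsub>W\<^esub> w \<in> carrier W"
    "\<forall>v \<in> carrier W. \<forall>w \<in> carrier W. v \<oplus>\<^bsub>W\<^esub> w = w \<oplus>\<^bsub>W\<^esub> v"
    "\<forall>u \<in> carrier W. \<forall>v \<in> carrier W. \<forall>w \<in> carrier W.
      (u \<oplus>\<^bsub>W\<^esub> v) \<oplus>\<^bsub>W\<^esub> w = u \<oplus>\<^bsub>W\<^esub> (v \<oplus>\<^bsub>W\<^esub> w)"
    "\<forall>v \<in> carrier W. v \<oplus>\<^bsub>W\<^esub> \<zero>\<^bsub>W\<^esub> = v"
    unfolding ball by (simp_all add: hom mem V.a_ac)
  moreover have "\<forall>v \<in> carrier W. \<forall>c \<in> carrier K. c \<odot>\<^bsub>W\<^esub> v \<in> carrier W"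
    "\<forall>v \<in> carrier W. \<forall>a \<in> carrier K. \<forall>b \<in> carrier K.
      (a \<otimes>\<^bsub>K\<^esub> b) \<odot>\<^bsub>W\<^esub> v = a \<odot>\<^bsub>W\<^esub> (b \<odot>\<^bsub>W\<^esub> v)"
    "\<forall>v \<in> carrier W. \<one>\<^bsub>K\<^esub> \<odot>\<^bsub>W\<^esub> v = v"
    "\<forall>v \<in> carrier W. \<forall>a \<in> carrier K. \<forall>b \<in> carrier K.
      (a \<oplus>\<^bsub>K\<^esub> b) \<odot>\<^bsub>W\<^esub> v = a \<odot>\<^bsub>W\<^esub> v \<oplus>\<^bsub>W\<^esub> b \<odot>\<^bsub>W\<^esub> v"
    "\<forall>v \<in> carrier W. \<forall>w \<in> carrier W. \<forall>a \<in> carrier K.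
      a \<odot>\<^bsub>W\<^esub> (v \<oplus>\<^bsub>W\<^esub> w) = a \<odot>\<^bsub>W\<^esub> v \<oplus>\<^bsub>W\<^esub> a \<odot>\<^bsub>W\<^esub> w"
    unfolding ball
    by (simp_all add: hom mem V.smult_assoc1 V.smult_l_distr V.smult_r_distr)
  ultimately show ?thesis
    by (intro vs_criteria V.field_axioms) (auto simp: mem simp flip: zero)
qed

lemma fin_dim_vectorspace_surj_image:
  assumes "fin_dim_vectorspace K V" and f: "f \<in> module_hom K V W"
    and surj: "f ` carrier V = carrier W" and zero: "f \<zero>\<^bsub>V\<^esub> = \<zero>\<^bsub>W\<^esub>"
  shows "fin_dim_vectorspace K W"
proof -
  interpret V: fin_dim_vectorspace K V by fact
  interpret W: vectorspace K W
    by (rule vectorspace_surj_image[OF V.vectorspace_axioms f surj zero])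
  interpret linear_map K V W f by unfold_locales (rule f)
  show ?thesis
    by unfold_locales (rule rank_nullity_main(2)[OF V.finite_dimensional surj])
qed

section \<open>Bilinear maps in curried form\<close>

lemma bilinear_map_closed:
  "\<lbrakk>bilinear_map K U V W \<rho>; x \<in> carrier U; v \<in> carrier V\<rbrakk> \<Longrightarrow> \<rho> x v \<in> carrier W"
  unfolding bilinear_map_def by (blast dest: module_hom_closed)

lemma bilinear_map_right:
  "\<lbrakk>bilinear_map K U V W \<rho>; x \<in> carrier U\<rbrakk> \<Longrightarrow> \<rho> x \<in> module_hom K V W"
  by (simp add: bilinear_map_def)

lemma bilinear_map_left:
  "\<lbrakk>bilinear_map K U V W \<rho>; v \<in> carrier V\<rbrakk> \<Longrightarrow> (\<lambda>x. \<rho> x v) \<in> module_hom K U W"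
  by (simp add: bilinear_map_def)

lemma bilinear_map_mod_hom_right:
  "\<lbrakk>bilinear_map K U V W \<rho>; module K V; module K W; x \<in> carrier U\<rbrakk> \<Longrightarrow> mod_hom K V W (\<rho> x)"
  by (simp add: bilinear_map_def mod_hom_def mod_hom_axioms_def)

lemma bilinear_map_mod_hom_left:
  "\<lbrakk>bilinear_map K U V W \<rho>; module K U; module K W; v \<in> carrier V\<rbrakk>
    \<Longrightarrow> mod_hom K U W (\<lambda>x. \<rho> x v)"
  by (simp add: bilinear_map_def mod_hom_def mod_hom_axioms_def)

lemma (in module) alternating_bilinear_antisym:
  assumes b: "bilinear_map R M M M b" and alt: "\<And>x. x \<in> carrier M \<Longrightarrow> b x x = \<zero>\<^bsub>M\<^esub>"
    and x: "x \<in> carrier M" and y: "y \<in> carrier M"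
  shows "b x y = \<ominus>\<^bsub>M\<^esub> b y x"
proof -
  note add = module_hom_add[OF bilinear_map_right[OF b]] module_hom_add[OF bilinear_map_left[OF b]]
  have closed: "b u v \<in> carrier M" if "u \<in> carrier M" "v \<in> carrier M" for u v
    using bilinear_map_closed[OF b that] .
  have "\<zero>\<^bsub>M\<^esub> = b (x \<oplus>\<^bsub>M\<^esub> y) (x \<oplus>\<^bsub>M\<^esub> y)"
    using x y by (simp add: alt)
  also have "\<dots> = (b x x \<oplus>\<^bsub>M\<^esub> b x y) \<oplus>\<^bsub>M\<^esub> (b y x \<oplus>\<^bsub>M\<^esub> b y y)"
    using x y by (simp only: add M.add.m_closed closed M.a_ac)
  also have "\<dots> = b x y \<oplus>\<^bsub>M\<^esub> b y x"
    using x y by (simp add: alt closed)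
  finally show ?thesis
    using x y by (simp add: M.minus_equality closed)
qed

section \<open>Linear maps on the span of a set\<close>

lemma mod_hom_span_eq_zero:
  assumes "mod_hom K M N f" and "S \<subseteq> carrier M" and "\<And>s. s \<in> S \<Longrightarrow> f s = \<zero>\<^bsub>N\<^esub>"
    and "z \<in> module.span K M S"
  shows "f z = \<zero>\<^bsub>N\<^esub>"
proof -
  interpret mod_hom K M N f by fact
  have "M.span S \<subseteq> ker"
    using assms(2,3) by (intro M.span_is_subset ker_is_submodule) (auto simp: ker_def)
  with assms(4) show ?thesis by (auto dest: f_ker)
qed

lemma (in mod_hom) mod_hom_span_in_submodule:
  assumes S: "S \<subseteq> carrier M" and P: "submodule R P N" and f: "\<And>s. s \<in> S \<Longrightarrow> f s \<in> P"
    and z: "z \<in> M.span S"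
  shows "f z \<in> P"
proof -
  have "submodule R {x \<in> carrier M. f x \<in> P} M"
    using P by (auto simp: submodule_def M.module_axioms)
  then have "M.span S \<subseteq> {x \<in> carrier M. f x \<in> P}"
    using S f by (intro M.span_is_subset) auto
  with z show ?thesis by blast
qed

section \<open>Passing between Lie and Leibniz algebras\<close>

context lie_algebra
begin

lemma bracket_closed [simp]:
  "\<lbrakk>x \<in> carrier \<gg>; y \<in> carrier \<gg>\<rbrakk> \<Longrightarrow> bracket \<gg> x y \<in> carrier \<gg>"
  by (rule bilinear_map_closed[OF bracket_bilinear])

lemma bracket_antisym:
  "\<lbrakk>x \<in> carrier \<gg>; y \<in> carrier \<gg>\<rbrakk> \<Longrightarrow> bracket \<gg> x y = \<ominus> bracket \<gg> y x"
  by (rule alternating_bilinear_antisym[OF bracket_bilinear alternating])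

lemma leibniz_algebra: "leibniz_algebra K \<gg>"
proof (unfold_locales, rule bracket_bilinear)
  fix x y z assume x: "x \<in> carrier \<gg>" and y: "y \<in> carrier \<gg>" and z: "z \<in> carrier \<gg>"
  interpret mod_hom K \<gg> \<gg> "bracket \<gg> y"
    using y by (intro bilinear_map_mod_hom_right[OF bracket_bilinear] module_axioms)
  have "bracket \<gg> y (bracket \<gg> z x) = \<ominus> bracket \<gg> y (bracket \<gg> x z)"
    using x z by (simp add: bracket_antisym[of z x])
  moreover have "bracket \<gg> z (bracket \<gg> x y) = \<ominus> bracket \<gg> (bracket \<gg> x y) z"
    using x y z by (intro bracket_antisym) auto
  \<comment> \<open>Antisymmetry has turned the last two terms of the cyclic Jacobi sum into the
    negatives of the right-hand terms of the left Leibniz identity.\<close>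
  ultimately have "bracket \<gg> x (bracket \<gg> y z) \<oplus>
      (\<ominus> (bracket \<gg> y (bracket \<gg> x z) \<oplus> bracket \<gg> (bracket \<gg> x y) z)) = \<zero>"
    using jacobi[OF x y z] x y z by (simp add: minus_add a_assoc)
  then show "bracket \<gg> x (bracket \<gg> y z) =
      bracket \<gg> (bracket \<gg> x y) z \<oplus> bracket \<gg> y (bracket \<gg> x z)"
    using x y z by (simp add: r_right_minus_eq flip: a_minus_def) (simp add: a_comm)
qed

end

context leibniz_algebra
begin

lemma bracket_closed [simp]:
  "\<lbrakk>x \<in> carrier \<GG>; y \<in> carrier \<GG>\<rbrakk> \<Longrightarrow> bracket \<GG> x y \<in> carrier \<GG>"
  by (rule bilinear_map_closed[OF bracket_bilinear])

lemma mod_hom_bracket_right: "x \<in> carrier \<GG> \<Longrightarrow> mod_hom K \<GG> \<GG> (bracket \<GG> x)"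
  by (intro bilinear_map_mod_hom_right[OF bracket_bilinear] module_axioms)

lemma mod_hom_bracket_left: "x \<in> carrier \<GG> \<Longrightarrow> mod_hom K \<GG> \<GG> (\<lambda>y. bracket \<GG> y x)"
  by (intro bilinear_map_mod_hom_left[OF bracket_bilinear] module_axioms)

lemmas bracket_add_right = module_hom_add[OF bilinear_map_right[OF bracket_bilinear]]
  and bracket_add_left = module_hom_add[OF bilinear_map_left[OF bracket_bilinear]]
  and bracket_smult_right = module_hom_smult[OF bilinear_map_right[OF bracket_bilinear]]
  and bracket_smult_left = module_hom_smult[OF bilinear_map_left[OF bracket_bilinear]]
  and bracket_neg_right = mod_hom.f_neg[OF mod_hom_bracket_right]

text \<open>Alternation gives antisymmetry, under which the left Leibniz identity becomes the Jacobi
  identity. The quotient can thus be built as a Leibniz algebra first, leaving only the squares to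
  be checked.\<close>

lemma lie_algebra_if_alternating:
  assumes alt: "\<And>x. x \<in> carrier \<GG> \<Longrightarrow> bracket \<GG> x x = \<zero>"
  shows "lie_algebra K \<GG>"
proof (unfold_locales, rule bracket_bilinear, fact alt)
  fix x y z assume x: "x \<in> carrier \<GG>" and y: "y \<in> carrier \<GG>" and z: "z \<in> carrier \<GG>"
  note antisym = alternating_bilinear_antisym[OF bracket_bilinear alt]
  have "bracket \<GG> y (bracket \<GG> z x) = \<ominus> bracket \<GG> y (bracket \<GG> x z)"
    using x y z by (simp add: antisym[of z x] bracket_neg_right)
  moreover have "bracket \<GG> z (bracket \<GG> x y) = \<ominus> bracket \<GG> (bracket \<GG> x y) z"
    using x y z by (intro antisym) auto
  ultimately show "bracket \<GG> x (bracket \<GG> y z) \<oplus> bracket \<GG> y (bracket \<GG> z x)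
      \<oplus> bracket \<GG> z (bracket \<GG> x y) = \<zero>"
    using x y z by (simp add: left_leibniz[of x y z] a_assoc r_neg r_neg1 r_neg2)
qed

end

lemma bracket_hom_restrict:
  assumes "leibniz_algebra K \<gg>" and "\<phi> \<in> bracket_hom K \<gg> \<hh>"
  shows "restrict \<phi> (carrier \<gg>) \<in> bracket_hom K \<gg> \<hh>"
proof -
  interpret leibniz_algebra K \<gg> by fact
  show ?thesis
    using assms(2) by (simp add: bracket_hom_def module_hom_restrict module_axioms)
qed

text \<open>The same transport as for vector spaces, with the bracket added. It is stated for
  Leibniz rather than Lie algebras because alternation fails in the source; it appears only through
  what \<open>f\<close> kills.\<close>

lemma leibniz_algebra_surj_image:
  assumes "leibniz_algebra K \<GG>" and f: "f \<in> bracket_hom K \<GG> \<HH>"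
    and surj: "f ` carrier \<GG> = carrier \<HH>" and zero: "f \<zero>\<^bsub>\<GG>\<^esub> = \<zero>\<^bsub>\<HH>\<^esub>"
  shows "leibniz_algebra K \<HH>"
proof -
  interpret G: leibniz_algebra K \<GG> by fact
  have f': "f \<in> module_hom K \<GG> \<HH>" using f by (simp add: bracket_hom_def)
  interpret H: fin_dim_vectorspace K \<HH>
    by (rule fin_dim_vectorspace_surj_image[OF G.fin_dim_vectorspace_axioms f' surj zero])
  have ball: "(\<forall>w \<in> carrier \<HH>. P w) \<longleftrightarrow> (\<forall>v \<in> carrier \<GG>. P (f v))" for P
    by (simp flip: surj)
  have mem: "f v \<in> carrier \<HH>" if "v \<in> carrier \<GG>" for v
    using surj that by blast
  have hom: "bracket \<HH> (f x) (f y) = f (bracket \<GG> x y)"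
    if "x \<in> carrier \<GG>" "y \<in> carrier \<GG>" for x y
    using f that by (simp add: bracket_hom_def)
  note hom = hom module_hom_add[OF f', symmetric] module_hom_smult[OF f', symmetric]
  have "\<forall>x \<in> carrier \<HH>. \<forall>y \<in> carrier \<HH>. bracket \<HH> x y \<in> carrier \<HH>"
    "\<forall>x \<in> carrier \<HH>. \<forall>y \<in> carrier \<HH>. \<forall>z \<in> carrier \<HH>.
      bracket \<HH> (x \<oplus>\<^bsub>\<HH>\<^esub> y) z = bracket \<HH> x z \<oplus>\<^bsub>\<HH>\<^esub> bracket \<HH> y z"
    "\<forall>x \<in> carrier \<HH>. \<forall>y \<in> carrier \<HH>. \<forall>z \<in> carrier \<HH>.
      bracket \<HH> z (x \<oplus>\<^bsub>\<HH>\<^esub> y) = bracket \<HH> z x \<oplus>\<^bsub>\<HH>\<^esub> bracket \<HH> z y"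
    "\<forall>x \<in> carrier \<HH>. \<forall>z \<in> carrier \<HH>. \<forall>r \<in> carrier K.
      bracket \<HH> (r \<odot>\<^bsub>\<HH>\<^esub> x) z = r \<odot>\<^bsub>\<HH>\<^esub> bracket \<HH> x z"
    "\<forall>x \<in> carrier \<HH>. \<forall>z \<in> carrier \<HH>. \<forall>r \<in> carrier K.
      bracket \<HH> z (r \<odot>\<^bsub>\<HH>\<^esub> x) = r \<odot>\<^bsub>\<HH>\<^esub> bracket \<HH> z x"
    unfolding ball
    by (simp_all add: hom mem G.bracket_add_right G.bracket_add_left G.bracket_smult_right
        G.bracket_smult_left)
  then have "bilinear_map K \<HH> \<HH> \<HH> (bracket \<HH>)"
    by (auto simp: bilinear_map_def module_hom_def)
  moreover have "\<forall>x \<in> carrier \<HH>. \<forall>y \<in> carrier \<HH>. \<forall>z \<in> carrier \<HH>.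
      bracket \<HH> x (bracket \<HH> y z) =
        bracket \<HH> (bracket \<HH> x y) z \<oplus>\<^bsub>\<HH>\<^esub> bracket \<HH> y (bracket \<HH> x z)"
    unfolding ball by (simp add: hom flip: G.left_leibniz)
  ultimately show ?thesis
    by unfold_locales blast+
qed

section \<open>The Lie quotient of a Leibniz algebra\<close>

definition leibniz_kernel :: "('k, 'r) ring_scheme \<Rightarrow> ('k, 'a) bracket_space \<Rightarrow> 'a set" where
  "leibniz_kernel K \<GG> = module.span K \<GG> {bracket \<GG> x x | x. x \<in> carrier \<GG>}"

text \<open>The choice predicate depends on \<open>x\<close> only through its coset, so congruent
  elements get the same representative, and two representatives agree exactly when the cosets
  do.\<close>

definition lie_repr :: "('k, 'r) ring_scheme \<Rightarrow> ('k, 'a) bracket_space \<Rightarrow> 'a \<Rightarrow> 'a" where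
  "lie_repr K \<GG> x = (SOME y. y \<in> carrier \<GG> \<and> x \<ominus>\<^bsub>\<GG>\<^esub> y \<in> leibniz_kernel K \<GG>)"

text \<open>
  The quotient is realised on coset representatives, because its elements have to be of the same
  type as those of the algebra.
\<close>

definition lie_quotient ::
  "('k, 'r) ring_scheme \<Rightarrow> ('k, 'a) bracket_space \<Rightarrow> ('k, 'a) bracket_space"
where
  "lie_quotient K \<GG> =
     \<GG>\<lparr>carrier := lie_repr K \<GG> ` carrier \<GG>,
       zero := lie_repr K \<GG> \<zero>\<^bsub>\<GG>\<^esub>,
       add := (\<lambda>x y. lie_repr K \<GG> (x \<oplus>\<^bsub>\<GG>\<^esub> y)),
       smult := (\<lambda>a x. lie_repr K \<GG> (a \<odot>\<^bsub>\<GG>\<^esub> x)),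
       bracket := (\<lambda>x y. lie_repr K \<GG> (bracket \<GG> x y))\<rparr>"

section \<open>The Leibniz kernel as an ideal\<close>

context leibniz_algebra
begin

lemma squares_subset: "{bracket \<GG> x x | x. x \<in> carrier \<GG>} \<subseteq> carrier \<GG>"
  by auto

lemma submodule_leibniz_kernel: "submodule K (leibniz_kernel K \<GG>) \<GG>"
  unfolding leibniz_kernel_def by (rule span_is_submodule[OF squares_subset])

lemma leibniz_kernel_subset: "leibniz_kernel K \<GG> \<subseteq> carrier \<GG>"
  using submodule_leibniz_kernel by (simp add: submodule_def)

lemma leibniz_kernel_closed:
  "\<zero> \<in> leibniz_kernel K \<GG>"
  "\<lbrakk>y \<in> leibniz_kernel K \<GG>; z \<in> leibniz_kernel K \<GG>\<rbrakk> \<Longrightarrow> y \<oplus> z \<in> leibniz_kernel K \<GG>"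
  "\<lbrakk>a \<in> carrier K; z \<in> leibniz_kernel K \<GG>\<rbrakk> \<Longrightarrow> a \<odot> z \<in> leibniz_kernel K \<GG>"
  using submodule_leibniz_kernel by (auto simp: submodule_def)

lemma leibniz_kernel_neg:
  assumes "z \<in> leibniz_kernel K \<GG>"
  shows "\<ominus> z \<in> leibniz_kernel K \<GG>"
proof -
  have "(\<ominus>\<^bsub>K\<^esub> \<one>\<^bsub>K\<^esub>) \<odot> z \<in> leibniz_kernel K \<GG>"
    using assms by (intro leibniz_kernel_closed) auto
  then show ?thesis
    using assms leibniz_kernel_subset by (simp add: smult_minus_1 subsetD)
qed

lemma square_in_leibniz_kernel: "x \<in> carrier \<GG> \<Longrightarrow> bracket \<GG> x x \<in> leibniz_kernel K \<GG>"
  unfolding leibniz_kernel_def using in_own_span[OF squares_subset] by blast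

text \<open>The sum is the square of \<open>x \<oplus> y\<close> minus the squares of
  \<open>x\<close> and \<open>y\<close>.\<close>

lemma polarization_in_leibniz_kernel:
  assumes x: "x \<in> carrier \<GG>" and y: "y \<in> carrier \<GG>"
  shows "bracket \<GG> x y \<oplus> bracket \<GG> y x \<in> leibniz_kernel K \<GG>"
proof -
  let ?s = "bracket \<GG> x y \<oplus> bracket \<GG> y x"
  have eq: "bracket \<GG> (x \<oplus> y) (x \<oplus> y) = bracket \<GG> x x \<oplus> (?s \<oplus> bracket \<GG> y y)"
    using x y by (simp add: bracket_add_left bracket_add_right a_ac)
  have "\<ominus> bracket \<GG> x x \<oplus> bracket \<GG> (x \<oplus> y) (x \<oplus> y) \<oplus> \<ominus> bracket \<GG> y y
      \<in> leibniz_kernel K \<GG>"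
    using x y by (intro leibniz_kernel_closed(2) leibniz_kernel_neg square_in_leibniz_kernel) auto
  also have "\<ominus> bracket \<GG> x x \<oplus> bracket \<GG> (x \<oplus> y) (x \<oplus> y) \<oplus> \<ominus> bracket \<GG> y y = ?s"
    unfolding eq using x y by (simp add: r_neg1 a_assoc r_neg)
  finally show ?thesis .
qed

lemma leibniz_kernel_hom_eq_zero:
  assumes "mod_hom K \<GG> M f" and "\<And>x. x \<in> carrier \<GG> \<Longrightarrow> f (bracket \<GG> x x) = \<zero>\<^bsub>M\<^esub>"
    and "z \<in> leibniz_kernel K \<GG>"
  shows "f z = \<zero>\<^bsub>M\<^esub>"
  using assms(2)
  by (intro mod_hom_span_eq_zero[OF assms(1) squares_subset _ assms(3)[unfolded leibniz_kernel_def]])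
    blast

text \<open>The left Leibniz identity for x, x, y reads [x,[x,y]] = [[x,x],y] + [x,[x,y]], so
  squares act as zero from the left.\<close>

lemma bracket_leibniz_kernel_left:
  assumes z: "z \<in> leibniz_kernel K \<GG>" and y: "y \<in> carrier \<GG>"
  shows "bracket \<GG> z y = \<zero>"
proof (rule leibniz_kernel_hom_eq_zero[OF mod_hom_bracket_left[OF y] _ z])
  fix x assume x: "x \<in> carrier \<GG>"
  then show "bracket \<GG> (bracket \<GG> x x) y = \<zero>"
    using left_leibniz[OF x x y] y by (simp add: a_comm)
qed

text \<open>From the right the bracket need not vanish, but [y,[x,x]] = [[y,x],x] + [x,[y,x]] is a
  polarized square.\<close>

lemma bracket_leibniz_kernel_right:
  assumes y: "y \<in> carrier \<GG>" and z: "z \<in> leibniz_kernel K \<GG>"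
  shows "bracket \<GG> y z \<in> leibniz_kernel K \<GG>"
proof (rule mod_hom.mod_hom_span_in_submodule[OF mod_hom_bracket_right[OF y] squares_subset
      submodule_leibniz_kernel _ z[unfolded leibniz_kernel_def]])
  fix s assume "s \<in> {bracket \<GG> x x | x. x \<in> carrier \<GG>}"
  then obtain x where x: "x \<in> carrier \<GG>" and s: "s = bracket \<GG> x x" by blast
  show "bracket \<GG> y s \<in> leibniz_kernel K \<GG>"
    unfolding s left_leibniz[OF y x x]
    using x y by (intro polarization_in_leibniz_kernel) auto
qed

section \<open>Coset representatives and the quotient\<close>

lemma lie_repr:
  assumes "x \<in> carrier \<GG>"
  shows lie_repr_closed: "lie_repr K \<GG> x \<in> carrier \<GG>"
    and lie_repr_diff: "x \<ominus> lie_repr K \<GG> x \<in> leibniz_kernel K \<GG>"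
proof -
  have "\<exists>y. y \<in> carrier \<GG> \<and> x \<ominus> y \<in> leibniz_kernel K \<GG>"
    using assms by (intro exI[of _ x]) (simp add: a_minus_def r_neg leibniz_kernel_closed)
  from someI_ex[OF this]
  show "lie_repr K \<GG> x \<in> carrier \<GG>" "x \<ominus> lie_repr K \<GG> x \<in> leibniz_kernel K \<GG>"
    by (auto simp: lie_repr_def)
qed

lemma lie_repr_cong:
  assumes x: "x \<in> carrier \<GG>" and y: "y \<in> carrier \<GG>" and xy: "x \<ominus> y \<in> leibniz_kernel K \<GG>"
  shows "lie_repr K \<GG> x = lie_repr K \<GG> y"
proof -
  \<comment> \<open>This makes the choice predicates of \<open>x\<close> and \<open>y\<close> equal
    as functions, so \<open>Eps\<close> picks the same element for both.\<close>
  have "x \<ominus> z \<in> leibniz_kernel K \<GG> \<longleftrightarrow> y \<ominus> z \<in> leibniz_kernel K \<GG>" if z: "z \<in> carrier \<GG>" for z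
  proof
    assume "x \<ominus> z \<in> leibniz_kernel K \<GG>"
    then have "\<ominus> (x \<ominus> y) \<oplus> (x \<ominus> z) \<in> leibniz_kernel K \<GG>"
      using xy by (intro leibniz_kernel_closed leibniz_kernel_neg)
    also have "\<ominus> (x \<ominus> y) \<oplus> (x \<ominus> z) = y \<ominus> z"
      using x y z by (simp add: a_minus_def minus_add a_ac r_neg r_neg1 r_neg2)
    finally show "y \<ominus> z \<in> leibniz_kernel K \<GG>" .
  next
    assume "y \<ominus> z \<in> leibniz_kernel K \<GG>"
    then have "(x \<ominus> y) \<oplus> (y \<ominus> z) \<in> leibniz_kernel K \<GG>"
      using xy by (intro leibniz_kernel_closed)
    also have "(x \<ominus> y) \<oplus> (y \<ominus> z) = x \<ominus> z"
      using x y z by (simp add: a_minus_def minus_add a_ac r_neg r_neg1 r_neg2)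
    finally show "x \<ominus> z \<in> leibniz_kernel K \<GG>" .
  qed
  then show ?thesis
    unfolding lie_repr_def by (intro arg_cong[where f = Eps] ext conj_cong refl)
qed

text \<open>The operations of the quotient already end in \<open>lie_repr\<close>, so what has to be
  shown is that they are well defined on cosets: replacing the arguments by their representatives
  changes the result by an element of the kernel.\<close>

lemma lie_repr_bracket_hom: "lie_repr K \<GG> \<in> bracket_hom K \<GG> (lie_quotient K \<GG>)"
proof -
  let ?r = "lie_repr K \<GG>"
  have "?r (x \<oplus> y) = ?r (?r x \<oplus> ?r y)" if x: "x \<in> carrier \<GG>" and y: "y \<in> carrier \<GG>" for x y
  proof (rule lie_repr_cong)
    have "(x \<ominus> ?r x) \<oplus> (y \<ominus> ?r y) \<in> leibniz_kernel K \<GG>"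
      using x y by (intro leibniz_kernel_closed lie_repr_diff)
    also have "(x \<ominus> ?r x) \<oplus> (y \<ominus> ?r y) = (x \<oplus> y) \<ominus> (?r x \<oplus> ?r y)"
      using x y by (simp add: a_minus_def minus_add a_ac lie_repr_closed)
    finally show "(x \<oplus> y) \<ominus> (?r x \<oplus> ?r y) \<in> leibniz_kernel K \<GG>" .
  qed (use x y in \<open>auto simp: lie_repr_closed\<close>)
  moreover have "?r (a \<odot> x) = ?r (a \<odot> ?r x)" if a: "a \<in> carrier K" and x: "x \<in> carrier \<GG>" for a x
  proof (rule lie_repr_cong)
    have "a \<odot> (x \<ominus> ?r x) \<in> leibniz_kernel K \<GG>"
      using a x by (intro leibniz_kernel_closed lie_repr_diff)
    also have "a \<odot> (x \<ominus> ?r x) = a \<odot> x \<ominus> a \<odot> ?r x"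
      using a x by (simp add: a_minus_def smult_r_distr smult_r_minus lie_repr_closed)
    finally show "a \<odot> x \<ominus> a \<odot> ?r x \<in> leibniz_kernel K \<GG>" .
  qed (use a x in \<open>auto simp: lie_repr_closed\<close>)
  moreover have "?r (bracket \<GG> x y) = ?r (bracket \<GG> (?r x) (?r y))"
    if x: "x \<in> carrier \<GG>" and y: "y \<in> carrier \<GG>" for x y
  proof (rule lie_repr_cong)
    have "bracket \<GG> (?r x) (y \<ominus> ?r y) \<in> leibniz_kernel K \<GG>"
      using x y by (intro bracket_leibniz_kernel_right lie_repr)
    \<comment> \<open>Replacing one argument at a time writes the difference of the two brackets as
      this sum. Its first term is zero and its second lies in the kernel.\<close>
    then have "bracket \<GG> (x \<ominus> ?r x) y \<oplus> bracket \<GG> (?r x) (y \<ominus> ?r y) \<in> leibniz_kernel K \<GG>"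
      using x y by (simp add: bracket_leibniz_kernel_left lie_repr)
    also have "bracket \<GG> (x \<ominus> ?r x) y \<oplus> bracket \<GG> (?r x) (y \<ominus> ?r y) =
        bracket \<GG> x y \<ominus> bracket \<GG> (?r x) (?r y)"
      using x y by (simp add: a_minus_def bracket_add_left bracket_add_right bracket_neg_right
          mod_hom.f_neg[OF mod_hom_bracket_left] lie_repr_closed a_ac r_neg r_neg1 r_neg2)
    finally show "bracket \<GG> x y \<ominus> bracket \<GG> (?r x) (?r y) \<in> leibniz_kernel K \<GG>" .
  qed (use x y in \<open>auto simp: lie_repr_closed\<close>)
  ultimately show ?thesis
    by (auto simp: bracket_hom_def module_hom_def lie_quotient_def)
qed

lemma lie_quotient_carrier: "carrier (lie_quotient K \<GG>) = lie_repr K \<GG> ` carrier \<GG>"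
  by (simp add: lie_quotient_def)

lemma lie_quotient_subset: "carrier (lie_quotient K \<GG>) \<subseteq> carrier \<GG>"
  by (auto simp: lie_quotient_carrier lie_repr_closed)

lemma lie_algebra_lie_quotient: "lie_algebra K (lie_quotient K \<GG>)"
proof (rule leibniz_algebra.lie_algebra_if_alternating)
  show "leibniz_algebra K (lie_quotient K \<GG>)"
    by (rule leibniz_algebra_surj_image[OF leibniz_algebra_axioms lie_repr_bracket_hom])
      (simp_all add: lie_quotient_def)
  fix x assume "x \<in> carrier (lie_quotient K \<GG>)"
  then have x: "x \<in> carrier \<GG>" using lie_quotient_subset by blast
  have neg_zero: "\<ominus> \<zero> = \<zero>"
    by (rule minus_equality) auto
  \<comment> \<open>The zero of the quotient is the representative of \<open>\<zero>\<close>, which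
    may be any element of the kernel; hence the comparison with \<open>\<zero>\<close> modulo the
    kernel.\<close>
  from x have "bracket \<GG> x x \<ominus> \<zero> \<in> leibniz_kernel K \<GG>"
    by (simp add: minus_eq neg_zero square_in_leibniz_kernel)
  with x have "lie_repr K \<GG> (bracket \<GG> x x) = lie_repr K \<GG> \<zero>"
    by (intro lie_repr_cong) auto
  then show "bracket (lie_quotient K \<GG>) x x = \<zero>\<^bsub>lie_quotient K \<GG>\<^esub>"
    by (simp add: lie_quotient_def)
qed

text \<open>\<open>f\<close> kills the kernel, which contains
  \<open>x \<ominus> lie_repr K \<GG> x\<close>. This serves both homomorphisms into Lie algebras
  and the linear maps x \<mapsto> \<rho>L x u.\<close>

lemma mod_hom_lie_repr:
  assumes f: "mod_hom K \<GG> M f" and sq: "\<And>x. x \<in> carrier \<GG> \<Longrightarrow> f (bracket \<GG> x x) = \<zero>\<^bsub>M\<^esub>"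
    and x: "x \<in> carrier \<GG>"
  shows "f (lie_repr K \<GG> x) = f x"
proof -
  interpret f: mod_hom K \<GG> M f by fact
  have "f x \<ominus>\<^bsub>M\<^esub> f (lie_repr K \<GG> x) = \<zero>\<^bsub>M\<^esub>"
    using leibniz_kernel_hom_eq_zero[OF f sq lie_repr_diff[OF x]] x
    by (simp add: lie_repr_closed)
  then show ?thesis
    using x by (simp add: lie_repr_closed)
qed

lemma bracket_hom_lie_repr:
  assumes "lie_algebra K \<hh>" and \<phi>: "\<phi> \<in> bracket_hom K \<GG> \<hh>" and x: "x \<in> carrier \<GG>"
  shows "\<phi> (lie_repr K \<GG> x) = \<phi> x"
proof -
  interpret h: lie_algebra K \<hh> by fact
  interpret mod_hom K \<GG> \<hh> \<phi>
    using \<phi> by unfold_locales (simp add: bracket_hom_def)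
  show ?thesis
    using \<phi> by (intro mod_hom_lie_repr[OF mod_hom_axioms _ x]) (simp add: bracket_hom_def h.alternating)
qed

text \<open>The induced map is \<open>\<phi>\<close> itself, read on representatives: it does not
  notice the \<open>lie_repr\<close> that ends each quotient operation.\<close>

lemma bracket_hom_lie_quotient:
  assumes h: "lie_algebra K \<hh>" and \<phi>: "\<phi> \<in> bracket_hom K \<GG> \<hh>"
  shows "\<phi> \<in> bracket_hom K (lie_quotient K \<GG>) \<hh>"
proof -
  interpret h: lie_algebra K \<hh> by fact
  have sub: "x \<in> carrier \<GG>" if "x \<in> carrier (lie_quotient K \<GG>)" for x
    using that lie_quotient_subset by blast
  have \<phi>': "\<phi> \<in> module_hom K \<GG> \<hh>"
    using \<phi> by (simp add: bracket_hom_def)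
  note repr = bracket_hom_lie_repr[OF h \<phi>]
  have "\<phi> (x \<oplus>\<^bsub>lie_quotient K \<GG>\<^esub> y) = \<phi> x \<oplus>\<^bsub>\<hh>\<^esub> \<phi> y"
    "\<phi> (bracket (lie_quotient K \<GG>) x y) = bracket \<hh> (\<phi> x) (\<phi> y)"
    if "x \<in> carrier (lie_quotient K \<GG>)" "y \<in> carrier (lie_quotient K \<GG>)" for x y
    using that[THEN sub] \<phi>
    by (simp_all add: lie_quotient_def repr module_hom_add[OF \<phi>'] bracket_hom_def)
  moreover have "\<phi> (a \<odot>\<^bsub>lie_quotient K \<GG>\<^esub> x) = a \<odot>\<^bsub>\<hh>\<^esub> \<phi> x"
    if "a \<in> carrier K" "x \<in> carrier (lie_quotient K \<GG>)" for a x
    using that(1) sub[OF that(2)]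
    by (simp add: lie_quotient_def repr module_hom_smult[OF \<phi>'])
  moreover have "\<phi> \<in> carrier (lie_quotient K \<GG>) \<rightarrow> carrier \<hh>"
    using module_hom_closed[OF \<phi>'] sub by blast
  ultimately show ?thesis
    unfolding bracket_hom_def module_hom_def by blast
qed

end

lemma (in leibniz_representation) \<rho>L_lie_repr:
  assumes x: "x \<in> carrier \<GG>" and u: "u \<in> carrier V"
  shows "\<rho>L (lie_repr K \<GG> x) u = \<rho>L x u"
proof (rule \<GG>.mod_hom_lie_repr[OF _ _ x])
  show "mod_hom K \<GG> V (\<lambda>x. \<rho>L x u)"
    using u by (intro bilinear_map_mod_hom_left[OF \<rho>L_linear] \<GG>.module_axioms module_axioms)
  fix y assume y: "y \<in> carrier \<GG>"
  then have "\<rho>L y (\<rho>L y u) \<in> carrier V"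
    using u by (intro bilinear_map_closed[OF \<rho>L_linear])
  with y u show "\<rho>L (bracket \<GG> y y) u = \<zero>"
    by (simp add: \<rho>L_bracket r_neg minus_eq)
qed

lemma (in leibniz_representation) lie_representation_lie_quotient:
  "lie_representation K (lie_quotient K \<GG>) V \<rho>L"
proof -
  interpret Q: lie_algebra K "lie_quotient K \<GG>"
    by (rule \<GG>.lie_algebra_lie_quotient)
  have sub: "x \<in> carrier \<GG>" if "x \<in> carrier (lie_quotient K \<GG>)" for x
    using that \<GG>.lie_quotient_subset by blast
  show ?thesis
  proof
    show "bilinear_map K (lie_quotient K \<GG>) V V \<rho>L"
      unfolding bilinear_map_def
    proof (intro conjI ballI)
      fix x assume "x \<in> carrier (lie_quotient K \<GG>)"
      then show "\<rho>L x \<in> module_hom K V V"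
        by (intro bilinear_map_right[OF \<rho>L_linear] sub)
    next
      fix u assume u: "u \<in> carrier V"
      note hom = bilinear_map_left[OF \<rho>L_linear u]
      have "\<rho>L (x \<oplus>\<^bsub>lie_quotient K \<GG>\<^esub> y) u = \<rho>L x u \<oplus> \<rho>L y u"
        if "x \<in> carrier (lie_quotient K \<GG>)" "y \<in> carrier (lie_quotient K \<GG>)" for x y
        using that[THEN sub] u module_hom_add[OF hom]
        by (simp add: lie_quotient_def \<rho>L_lie_repr)
      moreover have "\<rho>L (a \<odot>\<^bsub>lie_quotient K \<GG>\<^esub> x) u = a \<odot> \<rho>L x u"
        if "a \<in> carrier K" "x \<in> carrier (lie_quotient K \<GG>)" for a x
        using that(1) sub[OF that(2)] u module_hom_smult[OF hom]
        by (simp add: lie_quotient_def \<rho>L_lie_repr)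
      moreover have "(\<lambda>x. \<rho>L x u) \<in> carrier (lie_quotient K \<GG>) \<rightarrow> carrier V"
        using module_hom_closed[OF hom] sub by blast
      ultimately show "(\<lambda>x. \<rho>L x u) \<in> module_hom K (lie_quotient K \<GG>) V"
        unfolding module_hom_def by blast
    qed
  next
    fix x y u
    assume "x \<in> carrier (lie_quotient K \<GG>)" "y \<in> carrier (lie_quotient K \<GG>)" "u \<in> carrier V"
    then show "\<rho>L (bracket (lie_quotient K \<GG>) x y) u = \<rho>L x (\<rho>L y u) \<ominus> \<rho>L y (\<rho>L x u)"
      by (simp add: lie_quotient_def \<rho>L_lie_repr \<rho>L_bracket sub)
  qed
qed

section \<open>The adjunction for relative Rota-Baxter operators\<close>

definition rbo_lie_quotient ::
  "('k, 'r) ring_scheme \<Rightarrow> ('k, 'a, 'b) rbo_leibniz \<Rightarrow> ('k, 'a, 'b) rbo_lie"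
where
  "rbo_lie_quotient K A =
     \<lparr>lie_alg = lie_quotient K (leib_alg A),
      lie_mod = leib_mod A,
      lie_act = leib_actL A,
      lie_op = (\<lambda>u. lie_repr K (leib_alg A) (leib_op A u))\<rparr>"

context relative_rota_baxter_leibniz_sym
begin

lemma op_closed [simp]: "u \<in> carrier (leib_mod A) \<Longrightarrow> leib_op A u \<in> carrier (leib_alg A)"
  using module_hom_closed[OF op_linear] by blast

lemma actL_closed [simp]:
  "\<lbrakk>x \<in> carrier (leib_alg A); u \<in> carrier (leib_mod A)\<rbrakk> \<Longrightarrow> leib_actL A x u \<in> carrier (leib_mod A)"
  by (rule bilinear_map_closed[OF \<rho>L_linear])

lemma actR_closed [simp]:
  "\<lbrakk>x \<in> carrier (leib_alg A); u \<in> carrier (leib_mod A)\<rbrakk> \<Longrightarrow> leib_actR A x u \<in> carrier (leib_mod A)"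
  by (rule bilinear_map_closed[OF \<rho>R_linear])

lemma relative_rota_baxter_lie_quotient: "relative_rota_baxter_lie K (rbo_lie_quotient K A)"
proof -
  interpret Q: lie_representation K "lie_quotient K (leib_alg A)" "leib_mod A" "leib_actL A"
    by (rule lie_representation_lie_quotient)
  let ?r = "lie_repr K (leib_alg A)"
  have r: "?r \<in> module_hom K (leib_alg A) (lie_quotient K (leib_alg A))"
    "\<And>x y. \<lbrakk>x \<in> carrier (leib_alg A); y \<in> carrier (leib_alg A)\<rbrakk> \<Longrightarrow>
      bracket (lie_quotient K (leib_alg A)) (?r x) (?r y) = ?r (bracket (leib_alg A) x y)"
    using \<GG>.lie_repr_bracket_hom by (auto simp: bracket_hom_def)
  have "relative_rota_baxter_lie_axioms K (rbo_lie_quotient K A)"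
  proof
    show "lie_op (rbo_lie_quotient K A) \<in>
        module_hom K (lie_mod (rbo_lie_quotient K A)) (lie_alg (rbo_lie_quotient K A))"
      unfolding rbo_lie_quotient_def rbo_lie.simps by (rule module_hom_compose[OF op_linear r(1)])
  next
    fix u v
    assume "u \<in> carrier (lie_mod (rbo_lie_quotient K A))" "v \<in> carrier (lie_mod (rbo_lie_quotient K A))"
    then show "bracket (lie_alg (rbo_lie_quotient K A))
          (lie_op (rbo_lie_quotient K A) u) (lie_op (rbo_lie_quotient K A) v) =
        lie_op (rbo_lie_quotient K A)
          (lie_act (rbo_lie_quotient K A) (lie_op (rbo_lie_quotient K A) u) v
            \<ominus>\<^bsub>lie_mod (rbo_lie_quotient K A)\<^esub>
           lie_act (rbo_lie_quotient K A) (lie_op (rbo_lie_quotient K A) v) u)"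
      \<comment> \<open>With r for \<open>lie_repr\<close>: [r(Tu), r(Tv)] = r[Tu,Tv] =
        r(T(\<rho>L(Tu)v - \<rho>L(Tv)u)), and \<rho>L takes the same values at Tu and r(Tu), and at
        Tv and r(Tv).\<close>
      by (simp add: rbo_lie_quotient_def r(2) rota_baxter symmetric \<rho>L_lie_repr minus_eq)
  qed
  then show ?thesis
    by (simp add: relative_rota_baxter_lie_def rbo_lie_quotient_def Q.lie_representation_axioms)
qed

end

text \<open>The bracket rule for -\<rho> is the negative of the one for \<rho>, and both sides of
  the mixed identity equal -\<rho>(y)\<rho>(x)u.\<close>

lemma (in lie_representation) symmetric_leibniz_representation:
  "symmetric_leibniz_representation K \<gg> V \<rho> (\<lambda>x u. \<ominus> \<rho> x u)"
proof -
  interpret G: leibniz_algebra K \<gg>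
    by (rule \<gg>.leibniz_algebra)
  note closed [simp] = bilinear_map_closed[OF \<rho>_linear]
  have neg: "\<rho> x (\<ominus> u) = \<ominus> \<rho> x u" if "x \<in> carrier \<gg>" "u \<in> carrier V" for x u
    using that by (intro mod_hom.f_neg[of K] bilinear_map_mod_hom_right[OF \<rho>_linear] module_axioms)
  note add = module_hom_add[OF bilinear_map_right[OF \<rho>_linear]]
    module_hom_add[OF bilinear_map_left[OF \<rho>_linear]]
  note smult = module_hom_smult[OF bilinear_map_right[OF \<rho>_linear]]
    module_hom_smult[OF bilinear_map_left[OF \<rho>_linear]]
  show ?thesis
  proof
    show "bilinear_map K \<gg> V V \<rho>" by (rule \<rho>_linear)
    show "bilinear_map K \<gg> V V (\<lambda>x u. \<ominus> \<rho> x u)"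
      by (auto simp: bilinear_map_def module_hom_def add smult minus_add smult_r_minus)
  next
    fix x y u assume x: "x \<in> carrier \<gg>" and y: "y \<in> carrier \<gg>" and u: "u \<in> carrier V"
    show "\<rho> (bracket \<gg> x y) u = \<rho> x (\<rho> y u) \<ominus> \<rho> y (\<rho> x u)"
      by (rule \<rho>_bracket[OF x y u])
    show "\<ominus> \<rho> (bracket \<gg> x y) u = \<rho> x (\<ominus> \<rho> y u) \<ominus> (\<ominus> \<rho> y (\<rho> x u))"
      using x y u by (simp add: \<rho>_bracket neg minus_eq minus_add)
    show "\<ominus> \<rho> y (\<rho> x u) = \<ominus> (\<ominus> \<rho> y (\<ominus> \<rho> x u))"
      using x y u by (simp add: neg)
  qed simp
qed

lemma relative_rota_baxter_lie_to_leibniz: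
  assumes "relative_rota_baxter_lie K A"
  shows "relative_rota_baxter_leibniz_sym K (omap lie_to_leibniz A)"
proof -
  interpret relative_rota_baxter_lie K A by fact
  show ?thesis
    unfolding lie_to_leibniz_def functor_data.simps
    by (intro relative_rota_baxter_leibniz_sym.intro relative_rota_baxter_leibniz_sym_axioms.intro;
        \<comment> \<open>Adding the right action -\<rho> is folded back into a subtraction, after
          which the Rota-Baxter identity of the Lie operator is literally the required one.\<close>
        unfold rbo_leibniz.simps minus_eq[symmetric])
      (rule symmetric_leibniz_representation op_linear rota_baxter; assumption)+
qed

section \<open>Morphisms and category laws\<close>

lemma rbo_leibniz_hom_ident:
  assumes "relative_rota_baxter_leibniz_sym K A"
  shows "(\<lambda>x \<in> carrier (leib_alg A). x, \<lambda>u \<in> carrier (leib_mod A). u) \<in> rbo_leibniz_hom K A A"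
proof -
  interpret relative_rota_baxter_leibniz_sym K A by fact
  show ?thesis
    by (auto simp: rbo_leibniz_hom_def bracket_hom_def module_hom_def)
qed

lemma rbo_leibniz_homD:
  assumes "f \<in> rbo_leibniz_hom K A B"
  shows "fst f \<in> bracket_hom K (leib_alg A) (leib_alg B)"
    and "snd f \<in> module_hom K (leib_mod A) (leib_mod B)"
    and "fst f \<in> extensional (carrier (leib_alg A))"
    and "snd f \<in> extensional (carrier (leib_mod A))"
    and "fst f \<in> carrier (leib_alg A) \<rightarrow> carrier (leib_alg B)"
    and "snd f \<in> carrier (leib_mod A) \<rightarrow> carrier (leib_mod B)"
    and "u \<in> carrier (leib_mod A) \<Longrightarrow> leib_op B (snd f u) = fst f (leib_op A u)"
    and "\<lbrakk>x \<in> carrier (leib_alg A); u \<in> carrier (leib_mod A)\<rbrakk> \<Longrightarrow>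
      snd f (leib_actL A x u) = leib_actL B (fst f x) (snd f u)"
    and "\<lbrakk>x \<in> carrier (leib_alg A); u \<in> carrier (leib_mod A)\<rbrakk> \<Longrightarrow>
      snd f (leib_actR A x u) = leib_actR B (fst f x) (snd f u)"
  using assms
  by (simp_all add: rbo_leibniz_hom_def bracket_hom_def module_hom_def split_beta)

lemma rbo_leibniz_hom_compose:
  assumes "relative_rota_baxter_leibniz_sym K A"
    and f: "f \<in> rbo_leibniz_hom K A B" and g: "g \<in> rbo_leibniz_hom K B E"
  shows "(compose (carrier (leib_alg A)) (fst g) (fst f),
    compose (carrier (leib_mod A)) (snd g) (snd f)) \<in> rbo_leibniz_hom K A E"
proof -
  interpret relative_rota_baxter_leibniz_sym K A by fact
  note f = rbo_leibniz_homD[OF f] and g = rbo_leibniz_homD[OF g]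
  have "compose (carrier (leib_alg A)) (fst g) (fst f) \<in> bracket_hom K (leib_alg A) (leib_alg E)"
    unfolding compose_def
    by (rule bracket_hom_restrict[OF \<GG>.leibniz_algebra_axioms bracket_hom_compose[OF f(1) g(1)]])
  moreover have "compose (carrier (leib_mod A)) (snd g) (snd f) \<in> module_hom K (leib_mod A) (leib_mod E)"
    unfolding compose_def
    by (rule module_hom_restrict[OF module_axioms module_hom_compose[OF f(2) g(2)]])
  ultimately show ?thesis
    by (simp add: rbo_leibniz_hom_def compose_eq f(7-9) g(7-9) funcset_mem[OF f(5)] funcset_mem[OF f(6)])
qed

text \<open>The identity laws hold as equalities of functions because arrows are extensional:
  composing with an identity restricted to the carrier gives back \<open>undefined\<close> outside
  it.\<close>

lemma category_RBOLeibnizS: "category (RBOLeibnizS K)"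
  by unfold_locales
    (simp_all add: RBOLeibnizS_def rbo_leibniz_hom_ident rbo_leibniz_hom_compose
      Id_compose[OF rbo_leibniz_homD(5,3)] Id_compose[OF rbo_leibniz_homD(6,4)]
      compose_Id[OF rbo_leibniz_homD(5,3)] compose_Id[OF rbo_leibniz_homD(6,4)]
      compose_assoc[OF rbo_leibniz_homD(5)] compose_assoc[OF rbo_leibniz_homD(6)])

text \<open>Compatibility with the right actions is automatic, since a linear map commutes with
  negation.\<close>

lemma rbo_lie_hom_eq:
  assumes "relative_rota_baxter_lie K A" and "relative_rota_baxter_lie K B"
  shows "rbo_lie_hom K A B =
    rbo_leibniz_hom K (omap lie_to_leibniz A) (omap lie_to_leibniz B)"
proof -
  interpret A: relative_rota_baxter_lie K A by fact
  interpret B: relative_rota_baxter_lie K B by fact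
  have neg: "\<psi> (\<ominus>\<^bsub>lie_mod A\<^esub> lie_act A x u) = \<ominus>\<^bsub>lie_mod B\<^esub> \<psi> (lie_act A x u)"
    if "\<psi> \<in> module_hom K (lie_mod A) (lie_mod B)" "x \<in> carrier (lie_alg A)" "u \<in> carrier (lie_mod A)"
    for \<psi> x u
  proof -
    interpret mod_hom K "lie_mod A" "lie_mod B" \<psi>
      by unfold_locales fact
    show ?thesis using that by (simp add: bilinear_map_closed[OF A.\<rho>_linear])
  qed
  show ?thesis
    by (auto simp: rbo_lie_hom_def rbo_leibniz_hom_def lie_to_leibniz_def neg)
qed

lemma is_functor_lie_to_leibniz: "is_functor (RBOLie K) (RBOLeibnizS K) lie_to_leibniz"
proof -
  have "is_functor (RBOLie K) (RBOLeibnizS K) \<lparr>omap = omap lie_to_leibniz, amap = \<lambda>A B f. f\<rparr>"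
    by (rule is_functor_full_inclusion[OF category_RBOLeibnizS])
      (simp_all add: RBOLie_def RBOLeibnizS_def relative_rota_baxter_lie_to_leibniz rbo_lie_hom_eq,
        simp_all add: lie_to_leibniz_def)
  then show ?thesis by (simp add: lie_to_leibniz_def)
qed

lemma universal_arrow_rbo_lie_quotient:
  assumes "relative_rota_baxter_leibniz_sym K A"
  defines "\<eta> \<equiv> (restrict (lie_repr K (leib_alg A)) (carrier (leib_alg A)), \<lambda>u \<in> carrier (leib_mod A). u)"
  shows "\<eta> \<in> rbo_leibniz_hom K A (omap lie_to_leibniz (rbo_lie_quotient K A))"
    and "\<lbrakk>relative_rota_baxter_lie K B; g \<in> rbo_leibniz_hom K A (omap lie_to_leibniz B)\<rbrakk> \<Longrightarrow>
      \<exists>!f. f \<in> rbo_lie_hom K (rbo_lie_quotient K A) B \<and>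
        (compose (carrier (leib_alg A)) (fst f) (fst \<eta>),
         compose (carrier (leib_mod A)) (snd f) (snd \<eta>)) = g"
proof -
  interpret relative_rota_baxter_leibniz_sym K A by fact
  let ?r = "lie_repr K (leib_alg A)" and ?Q = "lie_quotient K (leib_alg A)"
  have sub: "x \<in> carrier (leib_alg A)" if "x \<in> carrier ?Q" for x
    using that \<GG>.lie_quotient_subset by blast
  interpret Q: lie_algebra K ?Q by (rule \<GG>.lie_algebra_lie_quotient)
  have "restrict ?r (carrier (leib_alg A)) \<in> bracket_hom K (leib_alg A) ?Q"
    by (intro bracket_hom_restrict \<GG>.leibniz_algebra_axioms \<GG>.lie_repr_bracket_hom)
  then show "\<eta> \<in> rbo_leibniz_hom K A (omap lie_to_leibniz (rbo_lie_quotient K A))"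
    by (auto simp: \<eta>_def rbo_leibniz_hom_def lie_to_leibniz_def rbo_lie_quotient_def \<rho>L_lie_repr
        symmetric module_hom_def)
  assume B: "relative_rota_baxter_lie K B" and g: "g \<in> rbo_leibniz_hom K A (omap lie_to_leibniz B)"
  interpret B: relative_rota_baxter_lie K B by fact
  obtain \<chi> \<psi> where g_eq: "g = (\<chi>, \<psi>)" by fastforce
  have \<chi>: "\<chi> \<in> bracket_hom K (leib_alg A) (lie_alg B)" "\<chi> \<in> extensional (carrier (leib_alg A))"
    and \<psi>: "\<psi> \<in> module_hom K (leib_mod A) (lie_mod B)" "\<psi> \<in> extensional (carrier (leib_mod A))"
    and op: "\<And>u. u \<in> carrier (leib_mod A) \<Longrightarrow> lie_op B (\<psi> u) = \<chi> (leib_op A u)"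
    and act: "\<And>x u. \<lbrakk>x \<in> carrier (leib_alg A); u \<in> carrier (leib_mod A)\<rbrakk> \<Longrightarrow>
      \<psi> (leib_actL A x u) = lie_act B (\<chi> x) (\<psi> u)"
    using g by (auto simp: g_eq rbo_leibniz_hom_def lie_to_leibniz_def)
  have \<chi>_repr: "\<chi> (?r x) = \<chi> x" if "x \<in> carrier (leib_alg A)" for x
    by (rule \<GG>.bracket_hom_lie_repr[OF B.\<gg>.lie_algebra_axioms \<chi>(1) that])
  have repr: "?r x \<in> carrier ?Q" if "x \<in> carrier (leib_alg A)" for x
    using that by (simp add: \<GG>.lie_quotient_carrier)
  show "\<exists>!f. f \<in> rbo_lie_hom K (rbo_lie_quotient K A) B \<and>
      (compose (carrier (leib_alg A)) (fst f) (fst \<eta>),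
       compose (carrier (leib_mod A)) (snd f) (snd \<eta>)) = g"
  \<comment> \<open>\<open>\<chi>\<close> is constant on cosets, so restricting it to the
    representatives yields the factor; the restriction also makes it extensional on the smaller
    carrier. On the space \<open>\<eta>\<close> is the identity, which forces
    \<open>\<psi>\<close>.\<close>
  proof (rule ex1I[of _ "(restrict \<chi> (carrier ?Q), \<psi>)"], intro conjI)
    have "restrict \<chi> (carrier ?Q) \<in> bracket_hom K ?Q (lie_alg B)"
      by (intro bracket_hom_restrict Q.leibniz_algebra \<GG>.bracket_hom_lie_quotient \<chi>
          B.\<gg>.lie_algebra_axioms)
    then show "(restrict \<chi> (carrier ?Q), \<psi>) \<in> rbo_lie_hom K (rbo_lie_quotient K A) B"
      using \<psi> by (simp add: rbo_lie_hom_def rbo_lie_quotient_def op act \<chi>_repr repr sub)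
    show "(compose (carrier (leib_alg A)) (fst (restrict \<chi> (carrier ?Q), \<psi>)) (fst \<eta>),
        compose (carrier (leib_mod A)) (snd (restrict \<chi> (carrier ?Q), \<psi>)) (snd \<eta>)) = g"
      using \<chi>(2) \<psi>(2)
      by (auto simp: \<eta>_def g_eq \<chi>_repr repr intro!: extensionalityI compose_extensional simp: compose_eq)
  next
    fix f
    assume f: "f \<in> rbo_lie_hom K (rbo_lie_quotient K A) B \<and>
      (compose (carrier (leib_alg A)) (fst f) (fst \<eta>),
       compose (carrier (leib_mod A)) (snd f) (snd \<eta>)) = g"
    obtain \<phi> \<psi>' where f_eq: "f = (\<phi>, \<psi>')" by fastforce
    have ext: "\<phi> \<in> extensional (carrier ?Q)" "\<psi>' \<in> extensional (carrier (leib_mod A))"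
      and \<chi>_eq: "\<chi> = compose (carrier (leib_alg A)) \<phi> (restrict ?r (carrier (leib_alg A)))"
      and \<psi>_eq: "\<psi> = compose (carrier (leib_mod A)) \<psi>' (\<lambda>u \<in> carrier (leib_mod A). u)"
      using f by (auto simp: f_eq g_eq \<eta>_def rbo_lie_hom_def rbo_lie_quotient_def)
    \<comment> \<open>Uniqueness comes from surjectivity of \<open>?r\<close>: for y = r(x), the
      factorisation prescribes \<chi>(x), and this is \<chi>(y).\<close>
    have "\<phi> y = \<chi> y" if y_in: "y \<in> carrier ?Q" for y
    proof -
      obtain x where x: "x \<in> carrier (leib_alg A)" and y: "y = ?r x"
        using y_in by (auto simp: \<GG>.lie_quotient_carrier)
      have "\<phi> y = \<chi> x" using x by (simp add: \<chi>_eq y compose_eq)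
      then show ?thesis using x by (simp add: y \<chi>_repr)
    qed
    then have "\<phi> = restrict \<chi> (carrier ?Q)"
      using ext(1) by (intro extensionalityI[of _ "carrier ?Q"]) auto
    moreover have "\<psi>' = \<psi>"
      using ext(2) \<psi>(2) by (intro extensionalityI[of _ "carrier (leib_mod A)"]) (auto simp: \<psi>_eq compose_eq)
    ultimately show "f = (restrict \<chi> (carrier ?Q), \<psi>)" by (simp add: f_eq)
  qed
qed

theorem theorem2p8:
  fixes K :: "('k, 'r) ring_scheme"
    and F :: "(('k, 'a, 'b) rbo_lie, ('a, 'b) rbo_arrow,
               ('k, 'a, 'b) rbo_leibniz, ('a, 'b) rbo_arrow) functor_data"
  assumes "alg_closed_field_char_0 K"
    and "F = lie_to_leibniz"
  shows "is_functor (RBOLie K) (RBOLeibnizS K) F \<and>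
         (\<exists>G. is_functor (RBOLeibnizS K) (RBOLie K) G \<and>
              left_adjoint (RBOLeibnizS K) (RBOLie K) G F)"
proof -
  have F: "is_functor (RBOLie K) (RBOLeibnizS K) F"
    unfolding assms(2) by (rule is_functor_lie_to_leibniz)
  have "\<exists>G. left_adjoint (RBOLeibnizS K) (RBOLie K) G F"
  proof (rule left_adjoint_of_universal_arrows[OF F])
    fix A assume "A \<in> Obj (RBOLeibnizS K :: (('k, 'a, 'b) rbo_leibniz, _) category)"
    then have A: "relative_rota_baxter_leibniz_sym K A" by (simp add: RBOLeibnizS_def)
    note univ = universal_arrow_rbo_lie_quotient[OF A]
    show "\<exists>B \<in> Obj (RBOLie K). \<exists>\<eta> \<in> Hom (RBOLeibnizS K) A (omap F B).
        \<forall>B' \<in> Obj (RBOLie K). \<forall>g \<in> Hom (RBOLeibnizS K) A (omap F B').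
          \<exists>!f. f \<in> Hom (RBOLie K) B B' \<and>
            Comp (RBOLeibnizS K) A (omap F B) (omap F B') (amap F B B' f) \<eta> = g"
    proof (intro bexI ballI)
      show "rbo_lie_quotient K A \<in> Obj (RBOLie K)"
        using relative_rota_baxter_leibniz_sym.relative_rota_baxter_lie_quotient[OF A]
        by (simp add: RBOLie_def)
      show "(restrict (lie_repr K (leib_alg A)) (carrier (leib_alg A)),
          \<lambda>u \<in> carrier (leib_mod A). u) \<in>
          Hom (RBOLeibnizS K) A (omap F (rbo_lie_quotient K A))"
        using univ(1) by (simp add: RBOLeibnizS_def assms(2))
      fix B' g
      assume "B' \<in> Obj (RBOLie K)" and "g \<in> Hom (RBOLeibnizS K) A (omap F B')"
      then show "\<exists>!f. f \<in> Hom (RBOLie K) (rbo_lie_quotient K A) B' \<and>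
          Comp (RBOLeibnizS K) A (omap F (rbo_lie_quotient K A)) (omap F B')
            (amap F (rbo_lie_quotient K A) B' f)
            (restrict (lie_repr K (leib_alg A)) (carrier (leib_alg A)),
             \<lambda>u \<in> carrier (leib_mod A). u) = g"
        using univ(2)[of B' g] by (simp add: RBOLie_def RBOLeibnizS_def lie_to_leibniz_def assms(2))
    qed
  qed
  with F show ?thesis unfolding left_adjoint_def by blast
qed

end
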